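(* Let $n=1$, and let $f,Q:\mathbb{R}\to\mathbb{R}$, $x_0,x_1,\tilde x_1,x_2,\tilde x_2\in\mathbb{R}$ and $\omega_1,\tilde\omega_1,\omega_2,\tilde\omega_2>0$ be as in the two-step trust-region setting described in the context. Assume that $f$ and $Q$ are nonconvex quadratic functions, that $\nabla^2 f+\omega_2>0$ and $\nabla^2 Q+\tilde\omega_2>0$, and that $\tilde x_1\neq x_1$. Put $$\kappa:=\frac{x_1-x_0}{\tilde x_1-x_1}\in\mathbb{R}.$$ Let $0\le\rho\le 1$. Then $$|\tilde x_2-x_2|\le\rho\,|\tilde x_1-x_1|$$ holds if and only if either $$(\nabla^2 Q+\tilde\omega_2)\,\omega_1>(\nabla^2 f+\omega_2)\,\tilde\omega_1\quad\text{and}\quad \kappa_1\le\kappa\le\kappa_2,$$ or $$(\nabla^2 Q+\tilde\omega_2)\,\omega_1<(\nabla^2 f+\omega_2)\,\tilde\omega_1\quad\text{and}\quad \kappa_2\le\kappa\le\kappa_1,$$ where $$\kappa_1=\frac{(\nabla^2 f+\omega_2)\left[(-\rho+1)(\nabla^2 Q+\tilde\omega_2)+\tilde\omega_1\right]}{(\nabla^2 Q+\tilde\omega_2)\omega_1-(\nabla^2 f+\omega_2)\tilde\omega_1},\qquad \kappa_2=\frac{(\nabla^2 f+\omega_2)\left[(\rho+1)(\nabla^2 Q+\tilde\omega_2)+\tilde\omega_1\right]}{(\nabla^2 Q+\tilde\omega_2)\omega_1-(\nabla^2 f+\omega_2)\tilde\omega_1}.$$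
   Context: Two-step trust-region setting (in dimension $n$). $f,Q:\mathbb{R}^n\to\mathbb{R}$ are nonconvex quadratic functions (polynomials of degree two whose Hessians are not positive semidefinite); $\nabla^2 f$ and $\nabla^2 Q$ denote their constant Hessians. $\boldsymbol{I}$ is the identity matrix, and $\mathcal{B}(x,\Delta)=\{z\in\mathbb{R}^n:\|z-x\|_2\le\Delta\}$. The point $x_0\in\mathbb{R}^n$ is the initial point and $\Delta_1,\tilde\Delta_1,\Delta_2,\tilde\Delta_2>0$ are trust-region radii. The points $x_1$ and $\tilde x_1$ are minimizers of $f$ in $\mathcal{B}(x_0,\Delta_1)$ and of $Q$ in $\mathcal{B}(x_0,\tilde\Delta_1)$, respectively; $x_2$ and $\tilde x_2$ are minimizers of $f$ in $\mathcal{B}(x_1,\Delta_2)$ and of $Q$ in $\mathcal{B}(\tilde x_1,\tilde\Delta_2)$, respectively. Expressed through optimality conditions, this means that $\omega_1,\tilde\omega_1,\omega_2,\tilde\omega_2>0$ are real numbers such that $$x_1-x_0=-(\nabla^2 f+\omega_1\boldsymbol{I})^{-1}\nabla f(x_0),\qquad \tilde x_1-x_0=-(\nabla^2 Q+\tilde\omega_1\boldsymbol{I})^{-1}\nabla Q(x_0),$$ $$x_2-x_1=-(\nabla^2 f+\omega_2\boldsymbol{I})^{-1}\nabla f(x_1),\qquad \tilde x_2-\tilde x_1=-(\nabla^2 Q+\tilde\omega_2\boldsymbol{I})^{-1}\nabla Q(\tilde x_1),$$ where $\Delta_1=\|x_1-x_0\|_2$, $\tilde\Delta_1=\|\tilde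 x_1-x_0\|_2$, $\Delta_2=\|x_2-x_1\|_2$, $\tilde\Delta_2=\|\tilde x_2-\tilde x_1\|_2$, and the four matrices $\nabla^2 f+\omega_1\boldsymbol{I}$, $\nabla^2 Q+\tilde\omega_1\boldsymbol{I}$, $\nabla^2 f+\omega_2\boldsymbol{I}$, $\nabla^2 Q+\tilde\omega_2\boldsymbol{I}$ are positive semidefinite (and invertible, as the formulas require). For $n=1$ the Hessians are real numbers and $\boldsymbol{I}=1$. *)

theory Defs
  imports "HOL-Analysis.Analysis" "HOL-Computational_Algebra.Polynomial"
begin

definition quadratic :: "(real \<Rightarrow> real) \<Rightarrow> bool" where
  "quadratic f \<longleftrightarrow> (\<exists>p :: real poly. degree p = 2 \<and> f = poly p)"

(* The Hessian of a quadratic function in dimension one. It is constant, so the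
   evaluation point 0 is immaterial (see hessian_quadratic below). *)
definition hessian :: "(real \<Rightarrow> real) \<Rightarrow> real" where
  "hessian f = deriv (deriv f) 0"

lemma hessian_quadratic:
  assumes "quadratic f"
  shows "deriv (deriv f) x = hessian f"
proof -
  obtain p where p: "degree p = 2" "f = poly p"
    using assms unfolding quadratic_def by blast
  have d: "deriv (poly q) = poly (pderiv q)" for q :: "real poly"
    by (rule ext) (rule DERIV_imp_deriv[OF poly_DERIV])
  have "degree (pderiv (pderiv p)) = 0"
    using p(1) by (simp add: degree_pderiv)
  then obtain c where "pderiv (pderiv p) = [:c:]"
    by (rule degree_eq_zeroE)
  then show ?thesis
    by (simp add: p(2) d hessian_def)
qed

(* For a 1 x 1 Hessian, "not positive semidefinite" means "not \<ge> 0". *)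
definition nonconvex_quadratic :: "(real \<Rightarrow> real) \<Rightarrow> bool" where
  "nonconvex_quadratic f \<longleftrightarrow> quadratic f \<and> \<not> 0 \<le> hessian f"

(* \<omega> is the multiplier of the step. For the 1 x 1 matrix hessian f + \<omega>, positive
   semidefinite and invertible mean \<ge> 0 and \<noteq> 0. Given the radius \<Delta>, the optimality
   conditions already imply minimality on the ball. *)
definition trust_region_step ::
  "(real \<Rightarrow> real) \<Rightarrow> real \<Rightarrow> real \<Rightarrow> real \<Rightarrow> real \<Rightarrow> bool" where
  "trust_region_step f x \<Delta> \<omega> y \<longleftrightarrow>
     \<Delta> > 0 \<and> \<omega> > 0 \<and>
     is_arg_min f (\<lambda>z. z \<in> cball x \<Delta>) y \<and>
     0 \<le> hessian f + \<omega> \<and> hessian f + \<omega> \<noteq> 0 \<and>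
     y - x = - (inverse (hessian f + \<omega>) * deriv f x) \<and>
     \<Delta> = norm (y - x)"

end

theory Submission
  imports Defs
begin

text \<open>A step with multiplier \<open>\<omega>\<close> leaves the gradient equal to \<open>- \<omega>\<close> times the step. Hence both
second steps are explicit multiples of the first ones, and \<open>x2t - x2\<close> is \<open>x1t - x1\<close> times an affine
function of \<open>\<kappa>\<close>, so the contraction condition is a two-sided bound on \<open>\<kappa>\<close> times the common
denominator of \<open>\<kappa>1\<close> and \<open>\<kappa>2\<close>. Its lower end is positive, which excludes a zero denominator.\<close>

text \<open>The derivative polynomial has degree one, and its slope is the value that
  \<open>hessian\<close> reads off at 0.\<close>

lemma deriv_quadratic_diff:
  assumes "quadratic f"
  shows "deriv f y = deriv f x + hessian f * (y - x)"
proof -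
  obtain p where p: "degree p = 2" "f = poly p"
    using assms unfolding quadratic_def by blast
  have d: "deriv (poly q) = poly (pderiv q)" for q :: "real poly"
    by (rule ext) (rule DERIV_imp_deriv[OF poly_DERIV])
  have "degree (pderiv p) = 1"
    using p(1) by (simp add: degree_pderiv)
  then obtain c e where "pderiv p = [:c, e:]"
    by (metis One_nat_def degree_eq_zeroE degree_pCons_eq_if nat.inject pCons_cases zero_neq_one)
  then show ?thesis
    by (simp add: p(2) d hessian_def pderiv_pCons algebra_simps)
qed

lemma trust_region_step_eq:
  assumes "trust_region_step f x \<Delta> \<omega> y"
  shows "(hessian f + \<omega>) * (y - x) = - deriv f x"
  using assms by (auto simp: trust_region_step_def)

text \<open>The step equation cancels the gradient at \<open>x\<close> and the Hessian term of the
  affine gradient, so only the multiplier term survives.\<close>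

lemma deriv_after_trust_region_step:
  assumes "quadratic f" and "trust_region_step f x \<Delta> \<omega> y"
  shows "deriv f y = - \<omega> * (y - x)"
  using deriv_quadratic_diff[OF assms(1), of y x] trust_region_step_eq[OF assms(2)]
  by (simp add: algebra_simps)

text \<open>Dividing by a negative \<open>D\<close> swaps the two ends. For \<open>D = 0\<close> the
  left side would give \<open>l \<le> 0\<close>, so both sides are false.\<close>

lemma between_divide_iff:
  fixes D :: real
  assumes "0 < l"
  shows "l \<le> k * D \<and> k * D \<le> u \<longleftrightarrow>
    0 < D \<and> l / D \<le> k \<and> k \<le> u / D \<or> D < 0 \<and> u / D \<le> k \<and> k \<le> l / D"
  using assms by (cases D "0 :: real" rule: linorder_cases) (auto simp: field_simps)

theorem theorem2p1:
  fixes f Q :: "real \<Rightarrow> real"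
    and x0 x1 x1t x2 x2t :: real
    and \<omega>1 \<omega>1t \<omega>2 \<omega>2t :: real
    and \<Delta>1 \<Delta>1t \<Delta>2 \<Delta>2t :: real
    and \<rho> \<kappa> \<kappa>1 \<kappa>2 :: real
  assumes "nonconvex_quadratic f" and "nonconvex_quadratic Q"
    and "trust_region_step f x0 \<Delta>1 \<omega>1 x1"
    and "trust_region_step Q x0 \<Delta>1t \<omega>1t x1t"
    and "trust_region_step f x1 \<Delta>2 \<omega>2 x2"
    and "trust_region_step Q x1t \<Delta>2t \<omega>2t x2t"
    and "hessian f + \<omega>2 > 0" and "hessian Q + \<omega>2t > 0"
    and "x1t \<noteq> x1"
    and "\<kappa> = (x1 - x0) / (x1t - x1)"
    and "0 \<le> \<rho>" and "\<rho> \<le> 1"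
    and "\<kappa>1 = (hessian f + \<omega>2) * ((- \<rho> + 1) * (hessian Q + \<omega>2t) + \<omega>1t)
               / ((hessian Q + \<omega>2t) * \<omega>1 - (hessian f + \<omega>2) * \<omega>1t)"
    and "\<kappa>2 = (hessian f + \<omega>2) * ((\<rho> + 1) * (hessian Q + \<omega>2t) + \<omega>1t)
               / ((hessian Q + \<omega>2t) * \<omega>1 - (hessian f + \<omega>2) * \<omega>1t)"
  shows "\<bar>x2t - x2\<bar> \<le> \<rho> * \<bar>x1t - x1\<bar> \<longleftrightarrow>
    ((hessian Q + \<omega>2t) * \<omega>1 > (hessian f + \<omega>2) * \<omega>1t \<and> \<kappa>1 \<le> \<kappa> \<and> \<kappa> \<le> \<kappa>2) \<or>
    ((hessian Q + \<omega>2t) * \<omega>1 < (hessian f + \<omega>2) * \<omega>1t \<and> \<kappa>2 \<le> \<kappa> \<and> \<kappa> \<le> \<kappa>1)"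
proof -
  define a b D where "a = hessian f + \<omega>2" and "b = hessian Q + \<omega>2t" and "D = b * \<omega>1 - a * \<omega>1t"
  define d where "d = x1t - x1"
  have pos: "0 < a" "0 < b" "0 < \<omega>1t" and d: "d \<noteq> 0"
    using assms(4,7-9) by (auto simp: a_def b_def d_def trust_region_step_def)
  have q: "quadratic f" "quadratic Q"
    using assms(1,2) by (auto simp: nonconvex_quadratic_def)
  \<comment> \<open>In units of \<open>d\<close>, the first step of \<open>f\<close> has length
    \<open>\<kappa>\<close>, and that of \<open>Q\<close> is one unit longer, both signed.\<close>
  have s: "x1 - x0 = \<kappa> * d" "x1t - x0 = (\<kappa> + 1) * d"
    using d assms(10) by (auto simp: d_def field_simps)
  have ea: "a * (x2 - x1) = \<omega>1 * (\<kappa> * d)"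
    using trust_region_step_eq[OF assms(5)] deriv_after_trust_region_step[OF q(1) assms(3)] s
    by (simp add: a_def)
  have eb: "b * (x2t - x1t) = \<omega>1t * ((\<kappa> + 1) * d)"
    using trust_region_step_eq[OF assms(6)] deriv_after_trust_region_step[OF q(2) assms(4)] s
    by (simp add: b_def)
  \<comment> \<open>Split \<open>x2t - x2\<close> as \<open>(x2t - x1t) + d - (x2 - x1)\<close>; the
    factor \<open>a * b\<close> clears the denominators of both second steps.\<close>
  have "a * b * (x2t - x2) = a * (b * (x2t - x1t)) + a * b * d - b * (a * (x2 - x1))"
    by (simp add: d_def algebra_simps)
  also have "\<dots> = (a * (b + \<omega>1t) - \<kappa> * D) * d"
    unfolding ea eb by (simp add: D_def algebra_simps)
  finally have "a * b * \<bar>x2t - x2\<bar> = \<bar>a * (b + \<omega>1t) - \<kappa> * D\<bar> * \<bar>d\<bar>"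
    using pos by (metis abs_mult abs_of_pos mult_pos_pos)
  moreover have "\<bar>x2t - x2\<bar> \<le> \<rho> * \<bar>d\<bar> \<longleftrightarrow> a * b * \<bar>x2t - x2\<bar> \<le> (a * b * \<rho>) * \<bar>d\<bar>"
    using pos by (simp add: mult.assoc)
  ultimately have "\<bar>x2t - x2\<bar> \<le> \<rho> * \<bar>d\<bar> \<longleftrightarrow> \<bar>a * (b + \<omega>1t) - \<kappa> * D\<bar> \<le> a * b * \<rho>"
    using d by (simp add: mult.assoc)
  \<comment> \<open>Shifting \<open>a * (b + \<omega>1t)\<close> by \<open>a * b * \<rho>\<close>
    down and up yields the numerators of \<open>\<kappa>1\<close> and
    \<open>\<kappa>2\<close>.\<close>
  also have "\<dots> \<longleftrightarrow> a * ((- \<rho> + 1) * b + \<omega>1t) \<le> \<kappa> * D \<and> \<kappa> * D \<le> a * ((\<rho> + 1) * b + \<omega>1t)"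
    by (auto simp: abs_le_iff algebra_simps)
  also have "\<dots> \<longleftrightarrow> 0 < D \<and> \<kappa>1 \<le> \<kappa> \<and> \<kappa> \<le> \<kappa>2 \<or> D < 0 \<and> \<kappa>2 \<le> \<kappa> \<and> \<kappa> \<le> \<kappa>1"
    \<comment> \<open>The lower end is positive: \<open>\<rho> \<le> 1\<close> makes
      \<open>(- \<rho> + 1) * b\<close> nonnegative, while \<open>\<omega>1t\<close> and
      \<open>a\<close> are positive.\<close>
    unfolding assms(13,14) a_def[symmetric] b_def[symmetric] D_def[symmetric]
    using pos assms(12) by (intro between_divide_iff mult_pos_pos add_nonneg_pos) auto
  finally show ?thesis
    by (simp add: D_def d_def a_def b_def)
qed

end
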